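(* Let $d\ge 1$ be a fixed integer that does not change with $n$, and let $C>0$ be a constant. Let $\mathbf{Y}\sim\mathrm{RDPG}(\mathbf{X})$ for some $\mathbf{X}=[\mathbf{x}_1,\ldots,\mathbf{x}_n]^{\mathrm T}$ with $\mathbf{x}_1,\ldots,\mathbf{x}_n\in\mathcal{X}$. Then there is a constant $c>0$, not depending on $n$, such that $$\inf_{\widehat{\mathbf{X}}}\ \sup_{\mathbf{X}\in\mathcal{X}^n}\ \mathbb{E}_{\mathbf{X}}\left\{\frac1n\inf_{\mathbf{W}\in\mathbb{O}(d)}\|\widehat{\mathbf{X}}-\mathbf{X}\mathbf{W}\|_{\mathrm F}^2\right\}\ \ge\ \frac{c}{n},$$ where the infimum is over all estimators $\widehat{\mathbf{X}}=\widehat{\mathbf{X}}(\mathbf{Y})\in\mathbb{R}^{n\times d}$ of the latent position matrix $\mathbf{X}$ satisfying $\|\widehat{\mathbf{X}}\|_{\mathrm F}\le C\sqrt n$ with probability one.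
   Context: The space of latent positions is $\mathcal{X}=\{\mathbf{x}\in\mathbb{R}^d:\|\mathbf{x}\|_2\le 1,\ \mathbf{x}\ge 0\}$ (with $\mathbf{x}\ge0$ entrywise), and $\mathcal{X}^n$ is the set of $n\times d$ matrices $\mathbf{X}=[\mathbf{x}_1,\ldots,\mathbf{x}_n]^{\mathrm T}$ whose rows $\mathbf{x}_1,\ldots,\mathbf{x}_n$ lie in $\mathcal{X}$. A symmetric random matrix $\mathbf{Y}=[y_{ij}]\in\{0,1\}^{n\times n}$ satisfies $\mathbf{Y}\sim\mathrm{RDPG}(\mathbf{X})$ (random dot product graph) if $y_{ij}\sim\mathrm{Bernoulli}(\mathbf{x}_i^{\mathrm T}\mathbf{x}_j)$ independently for $1\le i\le j\le n$. $\mathbb{E}_{\mathbf{X}}$ denotes expectation under $\mathbf{Y}\sim\mathrm{RDPG}(\mathbf{X})$. $\mathbb{O}(d)$ is the set of $d\times d$ orthogonal matrices and $\|\cdot\|_{\mathrm F}$ is the Frobenius norm. *)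

theory Defs
  imports "HOL-Analysis.Analysis" "HOL-Probability.Probability"
begin

(* The fixed dimension d is CARD('d).  As the number n of vertices varies, an n x d real matrix is
   given by its rows A 0, ..., A (n - 1), i.e. by a function A :: nat => real^'d of which only the
   values at indices below n matter; an n x n 0/1 matrix is a function nat => nat => nat. *)

definition latent_space :: "(real ^ 'd) set" where
  "latent_space = {x. norm x \<le> 1 \<and> (\<forall>k. 0 \<le> x $ k)}"

definition latent_matrices :: "nat \<Rightarrow> (nat \<Rightarrow> real ^ 'd) set" where
  "latent_matrices n = {..<n} \<rightarrow>\<^sub>E latent_space"

definition frob_norm :: "nat \<Rightarrow> (nat \<Rightarrow> real ^ 'd) \<Rightarrow> real" where
  "frob_norm n A = sqrt (\<Sum>i<n. \<Sum>k\<in>UNIV. (A i $ k)\<^sup>2)"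

(* The law of Y.  The upper triangle, diagonal included, consists of independent Bernoulli
   variables and is reflected to the lower one; entries at indices outside {..<n} are 0.
   bernoulli_pmf clamps its parameter to [0,1], which has no effect for X in latent_matrices n. *)
definition rdpg :: "nat \<Rightarrow> (nat \<Rightarrow> real ^ 'd) \<Rightarrow> (nat \<Rightarrow> nat \<Rightarrow> nat) pmf" where
  "rdpg n X =
     map_pmf (\<lambda>b i j. of_bool (b (min i j, max i j)))
       (Pi_pmf {(i, j). i \<le> j \<and> j < n} False (\<lambda>(i, j). bernoulli_pmf (X i \<bullet> X j)))"

(* "With probability one" is required under the law of every X in latent_matrices n.
   There is no measurability condition, as rdpg n X is discrete. *)
definition estimators ::
  "nat \<Rightarrow> real \<Rightarrow> ((nat \<Rightarrow> nat \<Rightarrow> nat) \<Rightarrow> nat \<Rightarrow> real ^ 'd) set" where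
  "estimators n C =
     {Xh. \<forall>X \<in> (latent_matrices n :: (nat \<Rightarrow> real ^ 'd) set).
            AE Y in measure_pmf (rdpg n X). frob_norm n (Xh Y) \<le> C * sqrt (real n)}"

(* Row i of the product X W is X i v* W. *)
definition loss :: "nat \<Rightarrow> (nat \<Rightarrow> real ^ 'd) \<Rightarrow> (nat \<Rightarrow> real ^ 'd) \<Rightarrow> real" where
  "loss n A X =
     1 / real n *
       (INF W \<in> {W :: real ^ 'd ^ 'd. orthogonal_matrix W}. (frob_norm n (\<lambda>i. A i - X i v* W))\<^sup>2)"

(* The following facts confirm that rdpg is the random dot product graph model. *)

lemma latent_inner_bounds:
  assumes "x \<in> latent_space" "y \<in> latent_space"
  shows "0 \<le> x \<bullet> y" "x \<bullet> y \<le> 1"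
proof -
  show "0 \<le> x \<bullet> y"
    using assms by (auto simp: latent_space_def inner_vec_def intro!: sum_nonneg mult_nonneg_nonneg)
  have "x \<bullet> y \<le> norm x * norm y"
    by (rule norm_cauchy_schwarz)
  also have "\<dots> \<le> 1 * 1"
    using assms by (intro mult_mono) (auto simp: latent_space_def)
  finally show "x \<bullet> y \<le> 1" by simp
qed

lemma finite_upper_triangle: "finite {(i, j). i \<le> j \<and> j < (n::nat)}"
  by (rule finite_subset[of _ "{..<n} \<times> {..<n}"]) auto

lemma rdpg_entry:
  assumes "i \<le> j" "j < n"
  shows "map_pmf (\<lambda>Y. Y i j) (rdpg n X) = map_pmf of_bool (bernoulli_pmf (X i \<bullet> X j))"
proof -
  let ?P = "Pi_pmf {(i, j). i \<le> j \<and> j < n} False (\<lambda>(i, j). bernoulli_pmf (X i \<bullet> X j))"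
  have "map_pmf (\<lambda>Y. Y i j) (rdpg n X) = map_pmf of_bool (map_pmf (\<lambda>b. b (i, j)) ?P)"
    using assms by (simp add: rdpg_def pmf.map_comp o_def min_def max_def)
  also have "map_pmf (\<lambda>b. b (i, j)) ?P = bernoulli_pmf (X i \<bullet> X j)"
    using assms by (subst Pi_pmf_component) (auto simp: finite_upper_triangle)
  finally show ?thesis .
qed

lemma rdpg_support:
  assumes "Y \<in> set_pmf (rdpg n X)"
  shows "Y i j = Y j i" "Y i j \<in> {0, 1}" "\<not> (i < n \<and> j < n) \<Longrightarrow> Y i j = 0"
proof -
  obtain b where b: "b \<in> set_pmf (Pi_pmf {(i, j). i \<le> j \<and> j < n} False
                                     (\<lambda>(i, j). bernoulli_pmf (X i \<bullet> X j)))"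
    and Y: "Y = (\<lambda>i j. of_bool (b (min i j, max i j)))"
    using assms by (auto simp: rdpg_def)
  show "Y i j = Y j i" by (simp add: Y min.commute max.commute)
  show "Y i j \<in> {0, 1}" by (simp add: Y)
  assume "\<not> (i < n \<and> j < n)"
  then have "(min i j, max i j) \<notin> {(i, j). i \<le> j \<and> j < n}" by auto
  then have "\<not> b (min i j, max i j)"
    using subsetD[OF set_Pi_pmf_subset[OF finite_upper_triangle] b] by simp
  then show "Y i j = 0" by (simp add: Y)
qed

lemma indep_vars_pmf_iff:
  "prob_space.indep_vars (measure_pmf p) (\<lambda>_. count_space UNIV) Z I \<longleftrightarrow>
     (\<forall>J\<subseteq>I. J \<noteq> {} \<longrightarrow> finite J \<longrightarrow> (\<forall>A\<in>(\<Pi> i\<in>J. {Z i -` S | S. True}).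
        measure_pmf.prob p (\<Inter>i\<in>J. A i) = (\<Prod>i\<in>J. measure_pmf.prob p (A i))))"
  unfolding prob_space.indep_vars_def2[OF prob_space_measure_pmf]
    prob_space.indep_sets_def[OF prob_space_measure_pmf]
  by simp

lemma indep_vars_map_pmf:
  assumes "prob_space.indep_vars (measure_pmf p) (\<lambda>_. count_space UNIV) (\<lambda>i b. Z i (g b)) I"
  shows "prob_space.indep_vars (measure_pmf (map_pmf g p)) (\<lambda>_. count_space UNIV) Z I"
  unfolding indep_vars_pmf_iff
proof (intro allI impI ballI)
  fix J A
  assume J: "J \<subseteq> I" "J \<noteq> {}" "finite J" and A: "A \<in> (\<Pi> i\<in>J. {Z i -` S | S. True})"
  have "(\<lambda>i. g -` A i) \<in> (\<Pi> i\<in>J. {(\<lambda>b. Z i (g b)) -` S | S. True})"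
  proof (rule Pi_I)
    fix i assume "i \<in> J"
    with A obtain S where "A i = Z i -` S" by blast
    then show "g -` A i \<in> {(\<lambda>b. Z i (g b)) -` S | S. True}" by (auto simp: vimage_def)
  qed
  with assms J have "measure_pmf.prob p (\<Inter>i\<in>J. g -` A i) = (\<Prod>i\<in>J. measure_pmf.prob p (g -` A i))"
    unfolding indep_vars_pmf_iff by blast
  then show "measure_pmf.prob (map_pmf g p) (\<Inter>i\<in>J. A i) =
      (\<Prod>i\<in>J. measure_pmf.prob (map_pmf g p) (A i))"
    by (simp add: vimage_INT)
qed

lemma rdpg_indep:
  "prob_space.indep_vars (measure_pmf (rdpg n X)) (\<lambda>_. count_space UNIV)
     (\<lambda>(i, j) Y. Y i j) {(i, j). i \<le> j \<and> j < n}"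
  unfolding rdpg_def
proof (rule indep_vars_map_pmf)
  let ?I = "{(i, j). i \<le> j \<and> j < n}"
  let ?P = "Pi_pmf ?I False (\<lambda>(i, j). bernoulli_pmf (X i \<bullet> X j))"
  let ?g = "\<lambda>b i j. of_bool (b (min i j, max i j)) :: nat"
  have "prob_space.indep_vars ?P (\<lambda>_. count_space UNIV) (\<lambda>e b. of_bool (b e) :: nat) ?I"
    by (rule prob_space.indep_vars_compose2[OF prob_space_measure_pmf
          indep_vars_Pi_pmf[OF finite_upper_triangle]]) auto
  moreover have "(\<lambda>b. (case e of (i, j) \<Rightarrow> \<lambda>Y. Y i j) (?g b)) = (\<lambda>b. of_bool (b e))"
    if "e \<in> ?I" for e
    using that by (auto simp: min_def max_def fun_eq_iff)
  ultimately show "prob_space.indep_vars ?P (\<lambda>_. count_space UNIV)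
      (\<lambda>e b. (case e of (i, j) \<Rightarrow> \<lambda>Y. Y i j) (?g b)) ?I"
    by (subst prob_space.indep_vars_cong[OF prob_space_measure_pmf refl _ refl]) auto
qed

end

theory Submission
  imports Defs
begin

text \<open>
  The supremum runs over all latent position matrices, including those with a single nonzero row,
  and already these force the rate. If all rows but the first vanish and the first row is \<open>x\<close>, then
  every edge probability is \<open>0\<close> except that of the loop at the first vertex, which is
  \<open>(norm x)\<^sup>2\<close>. The whole graph then carries one Bernoulli observation on \<open>norm x\<close>, however large
  \<open>n\<close> is, and one such observation cannot pin down \<open>norm x\<close>: the empty graph has probability \<open>1\<close>
  for \<open>x = 0\<close> and still \<open>3 / 4\<close> for a vector of norm \<open>1 / 2\<close> (lemma \<open>pmf_rdpg_spike_empty\<close>).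

  Rotations preserve norms, so the loss is at least \<open>1 / n\<close> times the squared error in the norm of
  the first row (lemma \<open>loss_ge_norm_diff\<close>). On seeing the empty graph, an estimator commits to one
  value \<open>r\<close> for this norm, which differs by at least \<open>1 / 4\<close> from \<open>0\<close> or from \<open>1 / 2\<close>. Hence for
  one of the two matrices the squared error is at least \<open>1 / 16\<close> with probability at least
  \<open>3 / 4\<close>, which gives \<open>c = 3 / 4 * 1 / 16 = 3 / 64\<close>.
\<close>

definition spike :: "nat \<Rightarrow> real ^ 'd \<Rightarrow> nat \<Rightarrow> real ^ 'd" where
  "spike n x = (\<lambda>i\<in>{..<n}. if i = 0 then x else 0)"

lemma spike_in_latent_matrices:
  assumes "x \<in> latent_space"
  shows "spike n x \<in> latent_matrices n"
  using assms by (auto simp: spike_def latent_matrices_def latent_space_def)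

lemma finite_set_pmf_rdpg: "finite (set_pmf (rdpg n X))"
proof -
  let ?I = "{(i, j). i \<le> j \<and> j < n}"
  have "finite (PiE_dflt ?I False (\<lambda>_. UNIV :: bool set))"
    by (intro finite_PiE_dflt finite_upper_triangle) auto
  moreover have "set_pmf (Pi_pmf ?I False (\<lambda>(i, j). bernoulli_pmf (X i \<bullet> X j)))
      \<subseteq> PiE_dflt ?I False (\<lambda>_. UNIV)"
    using set_Pi_pmf_subset[OF finite_upper_triangle] by (fastforce simp: PiE_dflt_def)
  ultimately show ?thesis
    unfolding rdpg_def by (auto intro: finite_subset)
qed

text \<open>The empty graph occurs exactly when no pair of the upper triangle is an edge; only the loop at
  the first vertex can be one.\<close>

lemma pmf_rdpg_spike_empty:
  fixes x :: "real ^ 'd"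
  assumes "n \<ge> 1" "x \<in> latent_space"
  shows "pmf (rdpg n (spike n x)) (\<lambda>i j. 0) \<ge> 1 - (norm x)\<^sup>2"
proof -
  let ?I = "{(i, j). i \<le> j \<and> j < n}"
  let ?B = "\<lambda>(i, j). bernoulli_pmf (spike n x i \<bullet> spike n x j)"
  let ?g = "\<lambda>b i j. of_bool (b (min i j, max i j)) :: nat"
  have "1 - (norm x)\<^sup>2 = 1 - x \<bullet> x"
    by (simp add: power2_norm_eq_inner)
  also have "\<dots> = (\<Prod>e\<in>?I. if e = (0, 0) then 1 - x \<bullet> x else 1)"
    using assms by (subst prod.delta) (auto simp: finite_upper_triangle)
  also have "\<dots> = (\<Prod>e\<in>?I. pmf (?B e) False)"
    using latent_inner_bounds[OF assms(2,2)] by (intro prod.cong) (auto simp: spike_def split: if_splits)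
  also have "\<dots> = pmf (Pi_pmf ?I False ?B) (\<lambda>_. False)"
    by (subst pmf_Pi') (auto simp: finite_upper_triangle)
  also have "\<dots> = measure_pmf.prob (Pi_pmf ?I False ?B) {\<lambda>_. False}"
    by (simp add: pmf.rep_eq)
  also have "\<dots> \<le> measure_pmf.prob (Pi_pmf ?I False ?B) (?g -` {\<lambda>i j. 0})"
    by (intro measure_pmf.finite_measure_mono) auto
  also have "\<dots> = pmf (rdpg n (spike n x)) (\<lambda>i j. 0)"
    by (simp add: rdpg_def pmf_map)
  finally show ?thesis .
qed

lemma norm_vector_matrix_mult_orthogonal:
  fixes W :: "real ^ 'd ^ 'd"
  assumes "orthogonal_matrix W"
  shows "norm (x v* W) = norm x"
proof -
  have "orthogonal_transformation ((*v) (transpose W))"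
    using assms by (simp add: orthogonal_transformation_matrix orthogonal_matrix_transpose)
  then show ?thesis
    by (simp add: orthogonal_transformation)
qed

lemma frob_norm_power2: "(frob_norm n A)\<^sup>2 = (\<Sum>i<n. (norm (A i))\<^sup>2)"
  by (simp add: frob_norm_def sum_nonneg norm_vec_def L2_set_def)

text \<open>The norm of each row is invariant under the rotations over which the loss minimises, so no
  choice of rotation can absorb an error in it.\<close>

lemma loss_ge_norm_diff:
  fixes X :: "nat \<Rightarrow> real ^ 'd"
  assumes "i < n"
  shows "loss n A X \<ge> 1 / real n * (norm (A i) - norm (X i))\<^sup>2"
proof -
  have "(norm (A i) - norm (X i))\<^sup>2 \<le> (frob_norm n (\<lambda>i. A i - X i v* W))\<^sup>2"
    if W: "orthogonal_matrix W" for W :: "real ^ 'd ^ 'd"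
  proof -
    have "\<bar>norm (A i) - norm (X i)\<bar> \<le> norm (A i - X i v* W)"
      using norm_triangle_ineq3[of "A i" "X i v* W"] norm_vector_matrix_mult_orthogonal[OF W]
      by simp
    then have "(norm (A i) - norm (X i))\<^sup>2 \<le> (norm (A i - X i v* W))\<^sup>2"
      by (metis abs_le_square_iff abs_norm_cancel)
    also have "\<dots> \<le> (frob_norm n (\<lambda>i. A i - X i v* W))\<^sup>2"
      unfolding frob_norm_power2 using assms by (intro member_le_sum) auto
    finally show ?thesis .
  qed
  then have "(norm (A i) - norm (X i))\<^sup>2 \<le>
      (INF W \<in> {W :: real ^ 'd ^ 'd. orthogonal_matrix W}. (frob_norm n (\<lambda>i. A i - X i v* W))\<^sup>2)"
    by (intro cINF_greatest) (auto intro: exI[of _ "mat 1"] orthogonal_matrix_id)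
  then show ?thesis
    unfolding loss_def by (intro mult_left_mono) auto
qed

lemma pmf_times_le_expectation:
  fixes f :: "'a \<Rightarrow> real"
  assumes "finite (set_pmf p)" "\<And>y. 0 \<le> f y"
  shows "pmf p y * f y \<le> measure_pmf.expectation p f"
proof -
  have "pmf p y * f y = measure_pmf.expectation p (\<lambda>z. indicator {y} z *\<^sub>R f y)"
    by (simp add: pmf.rep_eq)
  also have "\<dots> \<le> measure_pmf.expectation p f"
    using assms by (intro integral_mono integrable_measure_pmf_finite) (auto simp: indicator_def)
  finally show ?thesis .
qed

text \<open>Since the loss is nonnegative, the contribution of the empty graph alone bounds the risk from
  below. It depends on the estimator only through its answer to that graph, so the same number
  \<open>norm (Xh (\<lambda>i j. 0) 0)\<close> enters for every spike.\<close>

lemma risk_spike_ge: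
  fixes x :: "real ^ 'd"
  assumes "n \<ge> 1" "x \<in> latent_space"
  shows "measure_pmf.expectation (rdpg n (spike n x)) (\<lambda>Y. loss n (Xh Y) (spike n x))
    \<ge> (1 - (norm x)\<^sup>2) * (1 / real n * (norm (Xh (\<lambda>i j. 0) 0) - norm x)\<^sup>2)"
proof -
  let ?X = "spike n x" and ?Y = "\<lambda>i j. 0 :: nat"
  have loss: "loss n A ?X \<ge> 1 / real n * (norm (A 0) - norm x)\<^sup>2" for A
    using loss_ge_norm_diff[of 0 n A ?X] assms(1) by (simp add: spike_def)
  have nonneg: "loss n A ?X \<ge> 0" for A
    by (rule order_trans[OF _ loss]) simp
  have "(1 - (norm x)\<^sup>2) * (1 / real n * (norm (Xh ?Y 0) - norm x)\<^sup>2)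
      \<le> pmf (rdpg n ?X) ?Y * loss n (Xh ?Y) ?X"
    using pmf_rdpg_spike_empty[OF assms] loss by (intro mult_mono) auto
  also have "\<dots> \<le> measure_pmf.expectation (rdpg n ?X) (\<lambda>Y. loss n (Xh Y) ?X)"
    by (rule pmf_times_le_expectation[OF finite_set_pmf_rdpg nonneg])
  finally show ?thesis .
qed

theorem theorem2:
  fixes C :: real
  assumes "C > 0"
  shows "\<exists>c>0. \<forall>n\<ge>1.
    (INF Xh \<in> (estimators n C :: ((nat \<Rightarrow> nat \<Rightarrow> nat) \<Rightarrow> nat \<Rightarrow> real ^ 'd) set).
       SUP X \<in> latent_matrices n.
         ereal (measure_pmf.expectation (rdpg n X) (\<lambda>Y. loss n (Xh Y) X)))
    \<ge> ereal (c / real n)"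
proof (intro exI[of _ "3 / 64 :: real"] conjI allI impI INF_greatest)
  fix n :: nat and Xh :: "(nat \<Rightarrow> nat \<Rightarrow> nat) \<Rightarrow> nat \<Rightarrow> real ^ 'd"
  assume n: "n \<ge> 1"
  define r where "r = norm (Xh (\<lambda>i j. 0) 0)"
  \<comment> \<open>Of the two competing norms, take the one that \<open>r\<close> misses by more; any coordinate axis serves.\<close>
  define x :: "real ^ 'd" where "x = (if r \<ge> 1 / 4 then 0 else (1 / 2) *\<^sub>R axis undefined 1)"
  have x_norm: "norm x = (if r \<ge> 1 / 4 then 0 else 1 / 2)"
    by (simp add: x_def)
  have "0 \<le> x $ k" for k
    by (simp add: x_def axis_def)
  then have x: "x \<in> latent_space"
    by (simp add: latent_space_def x_norm)
  have "(1 / 4)\<^sup>2 \<le> (r - norm x)\<^sup>2"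
    by (subst abs_le_square_iff[symmetric]) (auto simp: x_norm)
  then have "3 / 4 * (1 / real n * (1 / 16)) \<le> (1 - (norm x)\<^sup>2) * (1 / real n * (r - norm x)\<^sup>2)"
    by (intro mult_mono) (auto simp: x_norm power2_eq_square divide_right_mono)
  also have "\<dots> \<le> measure_pmf.expectation (rdpg n (spike n x)) (\<lambda>Y. loss n (Xh Y) (spike n x))"
    unfolding r_def by (rule risk_spike_ge[OF n x])
  finally have "ereal (3 / 64 / real n)
      \<le> ereal (measure_pmf.expectation (rdpg n (spike n x)) (\<lambda>Y. loss n (Xh Y) (spike n x)))"
    by simp
  then show "ereal (3 / 64 / real n)
      \<le> (SUP X \<in> latent_matrices n.
           ereal (measure_pmf.expectation (rdpg n X) (\<lambda>Y. loss n (Xh Y) X)))"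
    by (rule SUP_upper2[OF spike_in_latent_matrices[OF x]])
qed simp

end
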